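(* Let $X=(X_t)_{t\ge 0}$ and $Y=(Y_t)_{t\ge 0}$ be stochastic processes with values in $E=\{e_1,\dots,e_n\}$ and $F=\{f_1,\dots,f_m\}$ respectively, and suppose that $Z_t=Y_t\otimes X_t$ is an $\mathbb{F}$-Markov chain with transition matrix $Q=\bar Q(\mathbf{1}_m^\top\otimes I_n)$, where $\bar Q\in\mathbb{R}^{nm\times n}$ is the matrix with stacked blocks $Q_1,\dots,Q_m\in\mathbb{R}^{n\times n}$; that is, $E[Z_{t+1}|\mathcal{F}_t]=\bar QX_t$ for all $t\ge0$. Then the filter $\hat X_t=E[X_t|\mathcal{F}^Y_t]$ satisfies, almost surely for all $t\ge1$, the recursion $$\hat X_t=\left[\frac{Q_1\hat X_{t-1}}{\mathbf{1}_n^\top Q_1\hat X_{t-1}}\ \cdots\ \frac{Q_m\hat X_{t-1}}{\mathbf{1}_n^\top Q_m\hat X_{t-1}}\right]Y_t,$$ with initial condition $\hat X_0=E[X_0|\sigma(Y_0)]$ determined by the initial law of $Z$. The prediction $\hat X_{t+1|t}=E[X_{t+1}|\mathcal{F}^Y_t]$ equals $A\hat X_t$ for $t\ge0$, with $A=\sum_{i=1}^mQ_i$, and $\hat X_{0|-1}=E X_0=p_0$. For the prediction $\hat Y_{t+1|t}=E[Y_{t+1}|\mathcal{F}^Y_t]$ one has $\hat Y_{t+1|t}=C\hat X_t$ for $t\ge0$, with $C=(I_m\otimes\mathbf{1}_n^\top)\bar Q$.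
   Context: All random variables live on a probability space $(\Omega,\mathcal{F},P)$; equalities of conditional expectations hold almost surely. $e_1,\dots,e_n$ are the standard basis vectors of $\mathbb{R}^n$ and $f_1,\dots,f_m$ those of $\mathbb{R}^m$; $\otimes$ is the Kronecker product, $I_m$ the $m\times m$ identity matrix, $\mathbf{1}_n$ the column vector of $n$ ones. $\mathcal{F}_t=\sigma\{X_0,\dots,X_t,Y_0,\dots,Y_t\}$, $\mathbb{F}=\{\mathcal{F}_t\}$, $\mathcal{F}^Y_t=\sigma\{Y_0,\dots,Y_t\}$, $\mathcal{F}^Y_{-1}$ trivial. The blocks have the interpretation $Q_iX_t=E[X_{t+1}1_{\{Y_{t+1}=f_i\}}|\mathcal{F}_t]$. The bracket in the recursion is the $n\times m$ matrix with the displayed columns; a column whose denominator is zero may be given any value (e.g. zero), since almost surely $Y_t$ does not select such a column. *)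

theory Defs
  imports "HOL-Probability.Probability"
begin

text \<open>Throughout, the index types \<open>'n\<close> and \<open>'m\<close> play the role of $\{1,\dots,n\}$ and
  $\{1,\dots,m\}$, and \<open>'m \<times> 'n\<close> that of $\{1,\dots,nm\}$ (block index first). The standard
  basis vectors are \<open>axis i 1\<close>, and the set of all of them is the library's \<open>Basis\<close>. Transition
  matrices act on column vectors from the left, so they are column-stochastic.\<close>

definition kron :: "real^'b^'a \<Rightarrow> real^'d^'c \<Rightarrow> real^('b \<times> 'd)^('a \<times> 'c)" where
  "kron A B = (\<chi> p q. A $ fst p $ fst q * B $ snd p $ snd q)"

definition kron_vec :: "real^'a \<Rightarrow> real^'b \<Rightarrow> real^('a \<times> 'b)" where
  "kron_vec y x = (\<chi> p. y $ fst p * x $ snd p)"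

text \<open>A Kronecker product with a row vector carries a factor \<open>1\<close> (the one-element type) in its
  row index type; these maps identify \<open>1 \<times> 'a\<close> and \<open>'a \<times> 1\<close> with \<open>'a\<close>.\<close>

definition drop_left_unit_rows :: "real^'b^(1 \<times> 'a) \<Rightarrow> real^'b^'a" where
  "drop_left_unit_rows A = (\<chi> i. A $ (1, i))"

definition drop_right_unit_rows :: "real^'b^('a \<times> 1) \<Rightarrow> real^'b^'a" where
  "drop_right_unit_rows A = (\<chi> i. A $ (i, 1))"

definition ones :: "real^'n" where
  "ones = vec 1"

definition ones_row :: "real^'n^1" where
  "ones_row = rowvector ones"

definition stack_blocks :: "('m::finite \<Rightarrow> real^'n^'n) \<Rightarrow> real^'n^('m \<times> 'n)" where
  "stack_blocks Q = (\<chi> p. Q (fst p) $ snd p)"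

text \<open>$Q = \bar Q(\mathbf{1}_m^\top\otimes I_n)$.\<close>

definition transition_matrix :: "('m::finite \<Rightarrow> real^'n^'n) \<Rightarrow> real^('m \<times> 'n)^('m \<times> 'n)" where
  "transition_matrix Q = stack_blocks Q ** drop_left_unit_rows (kron ones_row (mat 1))"

lemma transition_matrix_kron_vec:
  fixes Q :: "'m::finite \<Rightarrow> real^'n^'n"
  assumes "y \<in> Basis"
  shows "transition_matrix Q *v kron_vec y x = stack_blocks Q *v x"
proof -
  obtain k where y: "y = axis k 1"
    using assms by (auto simp: Basis_vec_def)
  have "(drop_left_unit_rows (kron ones_row (mat 1)) *v kron_vec y x) $ i = x $ i" for i :: 'n
  proof -
    have "(drop_left_unit_rows (kron ones_row (mat 1)) *v kron_vec y x) $ i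
        = (\<Sum>p\<in>UNIV \<times> UNIV. (if i = snd p then 1 else 0)
             * ((if k = fst p then 1 else 0) * x $ snd p))"
      unfolding UNIV_Times_UNIV
      by (auto simp: matrix_vector_mult_def drop_left_unit_rows_def kron_def ones_row_def
          rowvector_def ones_def mat_def kron_vec_def y axis_def intro!: sum.cong)
    also have "\<dots> = (\<Sum>a\<in>UNIV. \<Sum>b\<in>UNIV. (if k = a then (if i = b then x $ b else 0) else 0))"
      unfolding sum.cartesian_product by (auto intro!: sum.cong)
    also have "\<dots> = (\<Sum>a\<in>UNIV. if k = a then x $ i else 0)"
      by (rule sum.cong) auto
    finally show ?thesis by simp
  qed
  then have "drop_left_unit_rows (kron ones_row (mat 1)) *v kron_vec y x = x"
    by (simp add: vec_eq_iff)
  then show ?thesis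
    unfolding transition_matrix_def by (simp add: matrix_vector_mul_assoc [symmetric])
qed

definition column_stochastic :: "real^'s^'s \<Rightarrow> bool" where
  "column_stochastic P \<longleftrightarrow> (\<forall>j. (\<forall>i. 0 \<le> P $ i $ j) \<and> (\<Sum>i\<in>UNIV. P $ i $ j) = 1)"

text \<open>The library's \<open>real_cond_exp\<close> applied to every coordinate.\<close>

definition vec_cond_exp :: "'a measure \<Rightarrow> 'a measure \<Rightarrow> ('a \<Rightarrow> real^'k) \<Rightarrow> 'a \<Rightarrow> real^'k" where
  "vec_cond_exp M F V = (\<lambda>\<omega>. \<chi> i. real_cond_exp M F (\<lambda>\<omega>'. V \<omega>' $ i) \<omega>)"

text \<open>As the states are basis vectors, the coordinates of \<open>vec_cond_exp M (F t) (Z (Suc t))\<close> are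
  the conditional probabilities of \<open>Z (Suc t)\<close> being in the respective states.\<close>

definition markov_chain ::
    "'a measure \<Rightarrow> (nat \<Rightarrow> 'a measure) \<Rightarrow> (nat \<Rightarrow> 'a \<Rightarrow> real^'s) \<Rightarrow> real^'s^'s \<Rightarrow> bool" where
  "markov_chain M F Z P \<longleftrightarrow>
     column_stochastic P \<and>
     (\<forall>t. Z t \<in> borel_measurable (F t)) \<and>
     (\<forall>t. \<forall>\<omega>\<in>space M. Z t \<omega> \<in> Basis) \<and>
     (\<forall>t. AE \<omega> in M. vec_cond_exp M (F t) (Z (Suc t)) \<omega> = P *v Z t \<omega>)"

definition full_sigma ::
    "'a measure \<Rightarrow> (nat \<Rightarrow> 'a \<Rightarrow> real^'n) \<Rightarrow> (nat \<Rightarrow> 'a \<Rightarrow> real^'m) \<Rightarrow> nat \<Rightarrow> 'a measure" where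
  "full_sigma M X Y t = sigma (space M)
     (\<Union>s\<le>t. sets (vimage_algebra (space M) (X s) borel)
         \<union> sets (vimage_algebra (space M) (Y s) borel))"

definition obs_sigma :: "'a measure \<Rightarrow> (nat \<Rightarrow> 'a \<Rightarrow> real^'m) \<Rightarrow> nat \<Rightarrow> 'a measure" where
  "obs_sigma M Y t = sigma (space M) (\<Union>s\<le>t. sets (vimage_algebra (space M) (Y s) borel))"

text \<open>This is $\mathcal{F}^Y_{-1}$.\<close>

definition trivial_sigma :: "'a measure \<Rightarrow> 'a measure" where
  "trivial_sigma M = sigma (space M) {}"

definition filter_X ::
    "'a measure \<Rightarrow> (nat \<Rightarrow> 'a \<Rightarrow> real^'n) \<Rightarrow> (nat \<Rightarrow> 'a \<Rightarrow> real^'m) \<Rightarrow> nat \<Rightarrow> 'a \<Rightarrow> real^'n" where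
  "filter_X M X Y t = vec_cond_exp M (obs_sigma M Y t) (X t)"

text \<open>The matrix in the filter recursion. A column with vanishing denominator is given the
  arbitrary value \<open>d j\<close>.\<close>

definition filter_matrix :: "('m::finite \<Rightarrow> real^'n^'n) \<Rightarrow> ('m \<Rightarrow> real^'n) \<Rightarrow> real^'n \<Rightarrow> real^'m^'n" where
  "filter_matrix Q d x =
     (\<chi> i j. if ones \<bullet> (Q j *v x) = 0 then d j $ i
             else (Q j *v x) $ i / (ones \<bullet> (Q j *v x)))"

text \<open>Bayes' formula for the conditional law of $X_0$ given $Y_0 = y$, in terms of the law
  \<open>\<mu>\<close> of $Z_0 = Y_0 \otimes X_0$: the \<open>i\<close>-th entry is
  $\mu\{y \otimes e_i\} / \sum_k \mu\{y \otimes e_k\}$.\<close>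

definition initial_filter :: "(real^('m \<times> 'n)) measure \<Rightarrow> real^'m \<Rightarrow> real^'n" where
  "initial_filter \<mu> y =
     (\<chi> i. measure \<mu> {kron_vec y (axis i 1)} / (\<Sum>k\<in>UNIV. measure \<mu> {kron_vec y (axis k 1)}))"

text \<open>$C = (I_m\otimes\mathbf{1}_n^\top)\bar Q$.\<close>

definition output_matrix :: "('m::finite \<Rightarrow> real^'n^'n) \<Rightarrow> real^'n^'m" where
  "output_matrix Q = drop_right_unit_rows (kron (mat 1) ones_row) ** stack_blocks Q"

end

theory Submission
  imports Defs
begin

text \<open>By the tower property, conditioning the Markov property on the observations gives
  $E[Y_{t+1}^j X_{t+1}^i \mid \mathcal{F}^Y_t] = (Q_j \hat X_t)_i$; summing over \<open>j\<close> or over \<open>i\<close>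
  yields the two predictions. For the filter, an event of $\mathcal{F}^Y_{t+1}$ agrees on
  $\{Y_{t+1} = f_j\}$ with an event of $\mathcal{F}^Y_t$, and this gives Bayes' formula
  $E[V \mid \mathcal{F}^Y_{t+1}] = \sum_j Y_{t+1}^j\, E[Y_{t+1}^j V \mid \mathcal{F}^Y_t] /
  E[Y_{t+1}^j \mid \mathcal{F}^Y_t]$. The initial filter is the same formula over the trivial
  \<open>\<sigma>\<close>-algebra.\<close>

section \<open>Basis vectors, the matrices of the model, and events on which an observation is
  fixed\<close>

lemma Basis_vec_cases:
  assumes "y \<in> (Basis :: (real^'k) set)"
  obtains k where "y = axis k 1"
  using assms by (auto simp: Basis_vec_def)

text \<open>In Bayes' formula this leaves the one summand that belongs to the observed
  value.\<close>

lemma sum_axis_mult: "(\<Sum>j\<in>UNIV. axis k (1::real) $ j * c j) = c (k :: 'k::finite)"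
proof -
  have "(\<Sum>j\<in>UNIV. axis k (1::real) $ j * c j) = (\<Sum>j\<in>UNIV. if j = k then c j else 0)"
    by (rule sum.cong) (auto simp: axis_def)
  then show ?thesis by simp
qed

lemma Basis_nth_bounds:
  assumes "y \<in> (Basis :: (real^'k) set)"
  shows "0 \<le> y $ i" "y $ i \<le> 1"
  using assms by (auto elim!: Basis_vec_cases simp: axis_def)

lemma Basis_nth_eq_0:
  assumes "y \<in> (Basis :: (real^'k) set)" and "y \<noteq> axis j 1"
  shows "y $ j = 0"
proof -
  obtain k where y: "y = axis k 1"
    using assms(1) by (rule Basis_vec_cases)
  with assms(2) have "k \<noteq> j" by auto
  with y show ?thesis by (simp add: axis_def)
qed

lemma sum_Basis_nth:
  assumes "y \<in> (Basis :: (real^'k) set)"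
  shows "(\<Sum>i\<in>UNIV. y $ i) = 1"
  using assms sum_axis_mult[where c = "\<lambda>_. 1"] by (auto elim!: Basis_vec_cases)

lemma borel_measurable_vec_component:
  "V \<in> borel_measurable N \<Longrightarrow> (\<lambda>\<omega>. (V \<omega> :: real^'k) $ i) \<in> borel_measurable N"
  by (erule measurable_compose) (intro borel_measurable_continuous_onI continuous_intros)

lemma inner_ones: "ones \<bullet> x = (\<Sum>i\<in>UNIV. x $ i)"
  by (simp add: inner_vec_def ones_def)

text \<open>Multiplication by a basis vector selects a column, so the bracket in the recursion
  reduces to one normalised vector. The filler \<open>d\<close> shows up only if the selected column
  has denominator zero.\<close>

lemma filter_matrix_mult_axis:
  "filter_matrix Q d x *v axis j 1 =
     (if ones \<bullet> (Q j *v x) = 0 then d j else (1 / (ones \<bullet> (Q j *v x))) *\<^sub>R (Q j *v x))"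
  by (simp add: matrix_vector_mult_basis column_def filter_matrix_def vec_eq_iff)

text \<open>The Kronecker factor adds up the entries within each block, and block \<open>j\<close>
  of \<open>stack_blocks Q *v x\<close> is \<open>Q j *v x\<close>. The coordinates of the output
  are therefore the denominators in the filter recursion.\<close>

lemma output_matrix_mult:
  fixes Q :: "'m::finite \<Rightarrow> real^'n^'n"
  shows "(output_matrix Q *v x) $ j = ones \<bullet> (Q j *v x)"
proof -
  have "(drop_right_unit_rows (kron (mat 1) ones_row) *v z) $ j = (\<Sum>i\<in>UNIV. z $ (j, i))"
    for z :: "real^('m \<times> 'n)"
  proof -
    have "(drop_right_unit_rows (kron (mat 1) ones_row) *v z) $ j
        = (\<Sum>p\<in>UNIV \<times> UNIV. (if j = fst p then z $ p else 0))"
      unfolding UNIV_Times_UNIV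
      by (auto simp: matrix_vector_mult_def drop_right_unit_rows_def kron_def ones_row_def
          rowvector_def ones_def mat_def intro!: sum.cong)
    also have "\<dots> = (\<Sum>a\<in>UNIV. \<Sum>b\<in>UNIV. if j = a then z $ (a, b) else 0)"
      unfolding sum.cartesian_product by (auto intro!: sum.cong)
    also have "\<dots> = (\<Sum>a\<in>UNIV. if j = a then (\<Sum>b\<in>UNIV. z $ (a, b)) else 0)"
      by (rule sum.cong) auto
    finally show ?thesis by simp
  qed
  then have "(output_matrix Q *v x) $ j = (\<Sum>i\<in>UNIV. (stack_blocks Q *v x) $ (j, i))"
    unfolding output_matrix_def matrix_vector_mul_assoc [symmetric] .
  then show ?thesis
    by (simp add: inner_ones stack_blocks_def matrix_vector_mult_def)
qed

text \<open>Induction over the generated sigma-algebra: on the event that \<open>Y\<close> equals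
  \<open>axis j 1\<close> a set generated by \<open>Y\<close> is everything or nothing, and
  agreement on a fixed event survives complements and countable unions.\<close>

lemma trace_on_Basis_event:
  fixes Y :: "'a \<Rightarrow> real^'m"
  assumes "A \<in> sigma_sets (space G) (sets G \<union> sets (vimage_algebra (space G) Y borel))"
  shows "\<exists>B\<in>sets G. \<forall>\<omega>\<in>space G. Y \<omega> = axis j 1 \<longrightarrow> (\<omega> \<in> A \<longleftrightarrow> \<omega> \<in> B)"
  using assms
proof induction
  case (Basic a)
  then show ?case
  proof
    assume "a \<in> sets (vimage_algebra (space G) Y borel)"
    then obtain S where "a = Y -` S \<inter> space G"
      by (auto simp: sets_vimage_algebra2)
    \<comment> \<open>Where \<open>Y\<close> equals \<open>axis j 1\<close>, membership in the
      preimage of \<open>S\<close> depends only on whether \<open>S\<close> contains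
      \<open>axis j 1\<close>.\<close>
    then show ?thesis
      by (intro bexI[of _ "if axis j 1 \<in> S then space G else {}"]) auto
  qed auto
next
  case Empty
  then show ?case by auto
next
  case (Compl a)
  then obtain B where "B \<in> sets G" "\<forall>\<omega>\<in>space G. Y \<omega> = axis j 1 \<longrightarrow> (\<omega> \<in> a \<longleftrightarrow> \<omega> \<in> B)"
    by blast
  then show ?case by (intro bexI[of _ "space G - B"]) auto
next
  case (Union a)
  then obtain B where "\<And>i :: nat. B i \<in> sets G"
    "\<And>i. \<forall>\<omega>\<in>space G. Y \<omega> = axis j 1 \<longrightarrow> (\<omega> \<in> a i \<longleftrightarrow> \<omega> \<in> B i)"
    by metis
  then show ?case by (intro bexI[of _ "\<Union>i. B i"]) auto
qed

section \<open>Bayes' formula for conditional expectations, and the trivial sigma-algebra\<close>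

context prob_space
begin

lemma sigma_finite_subalgebraI: "subalgebra M F \<Longrightarrow> sigma_finite_subalgebra M F"
  by (intro finite_measure_subalgebra_is_sigma_finite finite_measure_subalgebra.intro
      finite_measure_axioms finite_measure_subalgebra_axioms.intro)

text \<open>\<open>G\<close> is the information before \<open>Y\<close> is observed and
  \<open>H\<close> the information afterwards. Leaving \<open>G\<close> general covers both the
  filter step and, with the trivial sigma-algebra as \<open>G\<close>, the initial filter.\<close>

lemma bayes_real_cond_exp:
  fixes Y :: "'a \<Rightarrow> real^'m"
  assumes G: "subalgebra M G" and H: "subalgebra M H"
    and HG: "sets H = sigma_sets (space M) (sets G \<union> sets (vimage_algebra (space M) Y borel))"
    and Y: "\<And>\<omega>. \<omega> \<in> space M \<Longrightarrow> Y \<omega> \<in> Basis"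
    and V[measurable]: "V \<in> borel_measurable M"
    and V01: "\<And>\<omega>. \<omega> \<in> space M \<Longrightarrow> 0 \<le> V \<omega> \<and> V \<omega> \<le> 1"
  shows "AE \<omega> in M. real_cond_exp M H V \<omega> =
    (\<Sum>j\<in>UNIV. Y \<omega> $ j * (real_cond_exp M G (\<lambda>\<omega>. Y \<omega> $ j * V \<omega>) \<omega>
                           / real_cond_exp M G (\<lambda>\<omega>. Y \<omega> $ j) \<omega>))"
proof -
  interpret G: sigma_finite_subalgebra M G by (rule sigma_finite_subalgebraI[OF G])
  interpret H: sigma_finite_subalgebra M H by (rule sigma_finite_subalgebraI[OF H])
  have spG: "space G = space M" and spH: "space H = space M"
    using G H by (auto simp: subalgebra_def)
  have "sets G \<subseteq> sets H" unfolding HG by auto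
  then have GH: "subalgebra H G" by (simp add: subalgebra_def spG spH)
  have Y_H: "Y \<in> borel_measurable H"
  proof (rule measurableI)
    fix S :: "(real^'m) set" assume "S \<in> sets borel"
    then have "Y -` S \<inter> space M \<in> sets (vimage_algebra (space M) Y borel)"
      by (rule in_vimage_algebra)
    then show "Y -` S \<inter> space H \<in> sets H" unfolding HG spH by auto
  qed simp
  note Yj_H[measurable] = borel_measurable_vec_component[OF Y_H]
  note Yj_M[measurable] = measurable_from_subalg[OF H Yj_H]
  note Y01 = Basis_nth_bounds[OF Y]
  define N where "N j = real_cond_exp M G (\<lambda>\<omega>. Y \<omega> $ j * V \<omega>)" for j
  define D where "D j = real_cond_exp M G (\<lambda>\<omega>. Y \<omega> $ j)" for j
  define r where "r j \<omega> = N j \<omega> / D j \<omega>" for j \<omega>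
  have N_G[measurable]: "N j \<in> borel_measurable G" and D_G[measurable]: "D j \<in> borel_measurable G" for j
    by (simp_all add: N_def D_def)
  have r_G[measurable]: "r j \<in> borel_measurable G" for j
    unfolding r_def by measurable
  note r_M[measurable] = measurable_from_subalg[OF G r_G]
    and r_H[measurable] = measurable_from_subalg[OF GH r_G]
  have YV01: "0 \<le> Y \<omega> $ j * V \<omega>" "Y \<omega> $ j * V \<omega> \<le> Y \<omega> $ j" if "\<omega> \<in> space M" for j \<omega>
    using that Y01[OF that, of j] V01[OF that] by (auto simp: mult_left_le)
  have iY: "integrable M (\<lambda>\<omega>. Y \<omega> $ j)" for j
    by (rule integrable_const_bound[where B = 1]) (auto simp: Y01)
  have iV: "integrable M V"
    by (rule integrable_const_bound[where B = 1]) (auto simp: V01)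
  have iYV: "integrable M (\<lambda>\<omega>. Y \<omega> $ j * V \<omega>)" for j
    by (rule integrable_const_bound[where B = 1]) (auto simp: YV01 intro!: AE_I2 order_trans[OF YV01(2)] Y01)
  \<comment> \<open>The pointwise bounds on \<open>Y \<omega> $ j * V \<omega>\<close> pass to the
    conditional expectations. They make the ratio \<open>r j\<close> bounded by 1, hence integrable
    against \<open>Y\<close>.\<close>
  have "AE \<omega> in M. 0 \<le> N j \<omega>" for j
    unfolding N_def by (rule G.real_cond_exp_pos) (auto simp: YV01)
  moreover have "AE \<omega> in M. N j \<omega> \<le> D j \<omega>" for j
    unfolding N_def D_def by (rule G.real_cond_exp_mono) (auto simp: YV01 iY iYV)
  ultimately have ND: "AE \<omega> in M. 0 \<le> N j \<omega> \<and> N j \<omega> \<le> D j \<omega>" for j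
    by (rule AE_conjI)
  have r1: "AE \<omega> in M. \<bar>r j \<omega>\<bar> \<le> 1" for j
    using ND[of j] by eventually_elim (auto simp: r_def divide_le_eq_1)
  \<comment> \<open>Where \<open>D j\<close> vanishes, so does \<open>N j\<close>, being squeezed
    between 0 and \<open>D j\<close>; the identity thus holds there too.\<close>
  have rD: "AE \<omega> in M. r j \<omega> * D j \<omega> = N j \<omega>" for j
    using ND[of j] by eventually_elim (auto simp: r_def)
  have iYr: "integrable M (\<lambda>\<omega>. Y \<omega> $ j * r j \<omega>)" for j
  proof (rule integrable_const_bound[where B = 1])
    show "AE \<omega> in M. norm (Y \<omega> $ j * r j \<omega>) \<le> 1"
      using r1[of j] by (rule AE_mp) (auto simp: abs_mult Y01 intro!: AE_I2 mult_le_one)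
  qed measurable
  \<comment> \<open>The candidate is \<open>H\<close>-measurable and integrable, so it suffices to
    compare integrals over the sets of \<open>H\<close>.\<close>
  have "AE \<omega> in M. real_cond_exp M H V \<omega> = (\<Sum>j\<in>UNIV. Y \<omega> $ j * r j \<omega>)"
  proof (rule H.real_cond_exp_charact)
    fix A assume A: "A \<in> sets H"
    have "\<exists>B\<in>sets G. \<forall>\<omega>\<in>space M. Y \<omega> = axis j 1 \<longrightarrow> (\<omega> \<in> A \<longleftrightarrow> \<omega> \<in> B)" for j
      using trace_on_Basis_event[of A G Y j] A HG spG by simp
    then obtain B where B_G[measurable]: "\<And>j. B j \<in> sets G"
      and AB: "\<And>j \<omega>. \<omega> \<in> space M \<Longrightarrow> Y \<omega> = axis j 1 \<Longrightarrow> \<omega> \<in> A \<longleftrightarrow> \<omega> \<in> B j"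
      by metis
    have B_M[measurable]: "B j \<in> sets M" for j
      using B_G G by (auto simp: subalgebra_def)
    have iB: "integrable M (\<lambda>\<omega>. indicator (B j) \<omega> * f \<omega>)" if "integrable M f" for j and f :: "'a \<Rightarrow> real"
      using integrable_mult_indicator[OF B_M that] by simp
    \<comment> \<open>The coordinate \<open>Y \<omega> $ j\<close> is zero off the event on which
      \<open>A\<close> and \<open>B j\<close> agree, so \<open>A\<close> may be exchanged for the
      \<open>G\<close>-set \<open>B j\<close> in the summand \<open>j\<close>.\<close>
    have ind: "indicator A \<omega> * (Y \<omega> $ j * c) = indicator (B j) \<omega> * (Y \<omega> $ j * c)"
      if "\<omega> \<in> space M" for j \<omega> and c :: real
      using AB[OF that, of j] Basis_nth_eq_0[OF Y[OF that], of j]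
      by (cases "Y \<omega> = axis j 1") (auto simp: indicator_def)
    \<comment> \<open>Applied twice: to \<open>V\<close> in every summand, and to the ratios
      \<open>r j\<close>.\<close>
    have trace: "(\<integral>\<omega>\<in>A. (\<Sum>j\<in>UNIV. Y \<omega> $ j * f j \<omega>) \<partial>M)
        = (\<Sum>j\<in>UNIV. \<integral>\<omega>. indicator (B j) \<omega> * (Y \<omega> $ j * f j \<omega>) \<partial>M)"
      if "\<And>j. integrable M (\<lambda>\<omega>. Y \<omega> $ j * f j \<omega>)" for f :: "'m \<Rightarrow> 'a \<Rightarrow> real"
    proof -
      have "(\<integral>\<omega>\<in>A. (\<Sum>j\<in>UNIV. Y \<omega> $ j * f j \<omega>) \<partial>M)
          = (\<integral>\<omega>. (\<Sum>j\<in>UNIV. indicator (B j) \<omega> * (Y \<omega> $ j * f j \<omega>)) \<partial>M)"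
        unfolding set_lebesgue_integral_def
        by (rule Bochner_Integration.integral_cong) (simp_all add: sum_distrib_left ind)
      also have "\<dots> = (\<Sum>j\<in>UNIV. \<integral>\<omega>. indicator (B j) \<omega> * (Y \<omega> $ j * f j \<omega>) \<partial>M)"
        by (rule Bochner_Integration.integral_sum) (rule iB[OF that])
      finally show ?thesis .
    qed
    have "(\<integral>\<omega>\<in>A. V \<omega> \<partial>M) = (\<integral>\<omega>\<in>A. (\<Sum>j\<in>UNIV. Y \<omega> $ j * V \<omega>) \<partial>M)"
      unfolding set_lebesgue_integral_def
      by (rule Bochner_Integration.integral_cong)
        (simp_all add: sum_distrib_right[symmetric] sum_Basis_nth[OF Y])
    also have "\<dots> = (\<Sum>j\<in>UNIV. \<integral>\<omega>. indicator (B j) \<omega> * (Y \<omega> $ j * V \<omega>) \<partial>M)"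
      by (rule trace) (rule iYV)
    also have "\<dots> = (\<Sum>j\<in>UNIV. \<integral>\<omega>. indicator (B j) \<omega> * (Y \<omega> $ j * r j \<omega>) \<partial>M)"
    proof (rule sum.cong)
      fix j
      \<comment> \<open>Conditioning on \<open>G\<close> is used in both directions. Since
        \<open>B j\<close> is in \<open>G\<close>, the product with \<open>V\<close> may be replaced
        by \<open>N j\<close>, which is \<open>r j\<close> times \<open>D j\<close>; since
        \<open>r j\<close> is \<open>G\<close>-measurable as well, \<open>D j\<close> may be
        replaced by \<open>Y \<omega> $ j\<close>.\<close>
      have "(\<integral>\<omega>. indicator (B j) \<omega> * (Y \<omega> $ j * V \<omega>) \<partial>M) = (\<integral>\<omega>. indicator (B j) \<omega> * N j \<omega> \<partial>M)"
        unfolding N_def by (rule G.real_cond_exp_intg(2)[symmetric]) (auto intro!: iB iYV)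
      also have "\<dots> = (\<integral>\<omega>. (indicator (B j) \<omega> * r j \<omega>) * D j \<omega> \<partial>M)"
        using rD[of j] measurable_from_subalg[OF G N_G] measurable_from_subalg[OF G D_G]
        by (intro integral_cong_AE) (auto elim!: eventually_mono)
      also have "\<dots> = (\<integral>\<omega>. (indicator (B j) \<omega> * r j \<omega>) * Y \<omega> $ j \<partial>M)"
        unfolding D_def using iB[OF iYr[of j], of j]
        by (intro G.real_cond_exp_intg(2)) (simp_all add: mult_ac)
      finally show "(\<integral>\<omega>. indicator (B j) \<omega> * (Y \<omega> $ j * V \<omega>) \<partial>M)
          = (\<integral>\<omega>. indicator (B j) \<omega> * (Y \<omega> $ j * r j \<omega>) \<partial>M)"
        by (simp add: mult_ac)
    qed simp
    also have "\<dots> = (\<integral>\<omega>\<in>A. (\<Sum>j\<in>UNIV. Y \<omega> $ j * r j \<omega>) \<partial>M)"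
      by (rule trace[symmetric]) (rule iYr)
    finally show "(\<integral>\<omega>\<in>A. V \<omega> \<partial>M) = (\<integral>\<omega>\<in>A. (\<Sum>j\<in>UNIV. Y \<omega> $ j * r j \<omega>) \<partial>M)" .
  qed (auto simp: iV iYr)
  then show ?thesis by (simp add: r_def N_def D_def)
qed

text \<open>The set where the conditional expectation vanishes is in \<open>G\<close>, so the
  integral of \<open>f\<close> over it is zero, and \<open>f\<close> is nonnegative. This is why the
  observation almost surely selects no column with denominator zero.\<close>

lemma AE_eq_0_if_real_cond_exp_eq_0:
  assumes "subalgebra M G" and f: "integrable M f" "\<And>\<omega>. \<omega> \<in> space M \<Longrightarrow> 0 \<le> f \<omega>"
  shows "AE \<omega> in M. real_cond_exp M G f \<omega> = 0 \<longrightarrow> f \<omega> = 0"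
proof -
  interpret sigma_finite_subalgebra M G by (rule sigma_finite_subalgebraI[OF assms(1)])
  define S where "S = {\<omega> \<in> space G. real_cond_exp M G f \<omega> = 0}"
  have S: "S \<in> sets G" unfolding S_def by measurable
  then have S_M: "S \<in> sets M" using assms(1) by (auto simp: subalgebra_def)
  have iS: "integrable M (\<lambda>\<omega>. indicator S \<omega> * f \<omega>)"
    using integrable_mult_indicator[OF S_M f(1)] by simp
  have "(\<integral>\<omega>. indicator S \<omega> * f \<omega> \<partial>M) = (\<integral>\<omega>. indicator S \<omega> * real_cond_exp M G f \<omega> \<partial>M)"
    using S iS f(1) by (intro real_cond_exp_intg(2)[symmetric]) auto
  also have "\<dots> = (\<integral>\<omega>. 0 \<partial>M)"
    by (rule Bochner_Integration.integral_cong) (auto simp: S_def indicator_def)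
  finally have "AE \<omega> in M. indicator S \<omega> * f \<omega> = 0"
    using integral_nonneg_eq_0_iff_AE[OF iS] f(2) by (auto intro!: AE_I2)
  then show ?thesis
    using assms(1) by (elim AE_mp) (auto simp: S_def subalgebra_def indicator_def intro!: AE_I2)
qed

lemma sets_trivial_sigma: "sets (trivial_sigma M) = {{}, space M}"
  by (simp add: trivial_sigma_def sigma_sets_empty_eq)

lemma subalgebra_trivial_sigma: "subalgebra M (trivial_sigma M)"
  unfolding subalgebra_def sets_trivial_sigma by (auto simp: trivial_sigma_def)

text \<open>Only the empty set and the whole space have to be tested against the constant.\<close>

lemma real_cond_exp_trivial_sigma:
  assumes "integrable M f"
  shows "AE \<omega> in M. real_cond_exp M (trivial_sigma M) f \<omega> = expectation f"
proof -
  interpret sigma_finite_subalgebra M "trivial_sigma M"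
    by (rule sigma_finite_subalgebraI[OF subalgebra_trivial_sigma])
  show ?thesis
  proof (rule real_cond_exp_charact)
    fix A assume "A \<in> sets (trivial_sigma M)"
    then consider "A = {}" | "A = space M" by (auto simp: sets_trivial_sigma)
    then show "(\<integral>\<omega>\<in>A. f \<omega> \<partial>M) = (\<integral>\<omega>\<in>A. expectation f \<partial>M)"
      by cases (simp_all add: set_lebesgue_integral_def set_integral_space assms
          Bochner_Integration.integral_cong[OF refl, of M "\<lambda>x. indicator (space M) x * _ x"] prob_space)
  qed (simp_all add: assms)
qed

end

section \<open>The sigma-algebras of the full history and of the observations\<close>

lemma space_obs_sigma [simp]: "space (obs_sigma M Y t) = space M"
  and sets_obs_sigma: "sets (obs_sigma M Y t) =
    sigma_sets (space M) (\<Union>s\<le>t. sets (vimage_algebra (space M) (Y s) borel))"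
proof -
  have "(\<Union>s\<le>t. sets (vimage_algebra (space M) (Y s) borel)) \<subseteq> Pow (space M)"
    by (auto dest!: sets.sets_into_space)
  then show "space (obs_sigma M Y t) = space M" "sets (obs_sigma M Y t) =
    sigma_sets (space M) (\<Union>s\<le>t. sets (vimage_algebra (space M) (Y s) borel))"
    by (simp_all add: obs_sigma_def)
qed

lemma space_full_sigma [simp]: "space (full_sigma M X Y t) = space M"
  and sets_full_sigma: "sets (full_sigma M X Y t) =
    sigma_sets (space M) (\<Union>s\<le>t. sets (vimage_algebra (space M) (X s) borel)
         \<union> sets (vimage_algebra (space M) (Y s) borel))"
proof -
  have "(\<Union>s\<le>t. sets (vimage_algebra (space M) (X s) borel)
         \<union> sets (vimage_algebra (space M) (Y s) borel)) \<subseteq> Pow (space M)"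
    by (auto dest!: sets.sets_into_space)
  then show "space (full_sigma M X Y t) = space M" "sets (full_sigma M X Y t) =
    sigma_sets (space M) (\<Union>s\<le>t. sets (vimage_algebra (space M) (X s) borel)
         \<union> sets (vimage_algebra (space M) (Y s) borel))"
    by (simp_all add: full_sigma_def)
qed

text \<open>Equality as measures, not only of the families of sets, allows rewriting inside
  \<open>vec_cond_exp\<close>. Both sides are built by \<open>sigma\<close> and carry the zero
  measure.\<close>

lemma obs_sigma_0: "obs_sigma M Y 0 = vimage_algebra (space M) (Y 0) borel"
proof (rule measure_eqI)
  show "sets (obs_sigma M Y 0) = sets (vimage_algebra (space M) (Y 0) borel)"
    using sets.sigma_sets_eq[of "vimage_algebra (space M) (Y 0) borel"]
    by (simp add: sets_obs_sigma)
qed (simp add: obs_sigma_def vimage_algebra_def emeasure_sigma)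

text \<open>This is the form that \<open>bayes_real_cond_exp\<close> requires for one more
  observation.\<close>

lemma sets_obs_sigma_Suc:
  "sets (obs_sigma M Y (Suc t)) =
    sigma_sets (space M) (sets (obs_sigma M Y t) \<union> sets (vimage_algebra (space M) (Y (Suc t)) borel))"
  (is "_ = sigma_sets _ (_ \<union> ?V)")
proof (rule antisym)
  show "sets (obs_sigma M Y (Suc t)) \<subseteq> sigma_sets (space M) (sets (obs_sigma M Y t) \<union> ?V)"
    unfolding sets_obs_sigma atMost_Suc by (rule sigma_sets_mono) auto
  show "sigma_sets (space M) (sets (obs_sigma M Y t) \<union> ?V) \<subseteq> sets (obs_sigma M Y (Suc t))"
    unfolding sets_obs_sigma
    by (intro sigma_sets_mono Un_least) (auto intro!: sigma_sets.Basic le_SucI)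
qed

text \<open>The counterpart at time 0, with the trivial sigma-algebra as the information before the
  first observation.\<close>

lemma (in prob_space) sets_obs_sigma_0:
  "sets (obs_sigma M Y 0) =
    sigma_sets (space M) (sets (trivial_sigma M) \<union> sets (vimage_algebra (space M) (Y 0) borel))"
proof -
  have "sets (trivial_sigma M) \<union> sets (vimage_algebra (space M) (Y 0) borel)
      = sets (vimage_algebra (space M) (Y 0) borel)"
    using sets.top[of "vimage_algebra (space M) (Y 0) borel"] by (auto simp: sets_trivial_sigma)
  then show ?thesis by (simp add: sets_obs_sigma)
qed

lemma sets_vimage_borel_subset:
  assumes "V \<in> borel_measurable M"
  shows "sets (vimage_algebra (space M) V borel) \<subseteq> sets M"
  using assms by (auto simp: sets_vimage_algebra2 dest: measurable_sets)

lemma subalgebra_full_sigma: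
  assumes "\<And>s. X s \<in> borel_measurable M" "\<And>s. Y s \<in> borel_measurable M"
  shows "subalgebra M (full_sigma M X Y t)"
  unfolding subalgebra_def sets_full_sigma
  by (intro conjI sets.sigma_sets_subset UN_least Un_least sets_vimage_borel_subset assms) simp

lemma subalgebra_full_obs: "subalgebra (full_sigma M X Y t) (obs_sigma M Y t)"
  unfolding subalgebra_def sets_full_sigma sets_obs_sigma
  by (intro conjI sigma_sets_mono') auto

section \<open>The hidden Markov model: predictions, filter step and initial conditions\<close>

locale hidden_markov_model = prob_space M
  for M :: "'a measure" +
  fixes X :: "nat \<Rightarrow> 'a \<Rightarrow> real^'n"
    and Y :: "nat \<Rightarrow> 'a \<Rightarrow> real^'m"
    and Q :: "'m::finite \<Rightarrow> real^'n^'n"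
  assumes X_M: "\<And>t. X t \<in> borel_measurable M"
    and Y_M: "\<And>t. Y t \<in> borel_measurable M"
    and X_Basis: "\<And>t \<omega>. \<omega> \<in> space M \<Longrightarrow> X t \<omega> \<in> Basis"
    and Y_Basis: "\<And>t \<omega>. \<omega> \<in> space M \<Longrightarrow> Y t \<omega> \<in> Basis"
    and markov: "markov_chain M (full_sigma M X Y) (\<lambda>t \<omega>. kron_vec (Y t \<omega>) (X t \<omega>)) (transition_matrix Q)"
begin

lemmas X_component [measurable] = borel_measurable_vec_component[OF X_M]
  and Y_component [measurable] = borel_measurable_vec_component[OF Y_M]

lemma X_bounds: "\<omega> \<in> space M \<Longrightarrow> 0 \<le> X t \<omega> $ i \<and> X t \<omega> $ i \<le> 1"
  and Y_bounds: "\<omega> \<in> space M \<Longrightarrow> 0 \<le> Y t \<omega> $ j \<and> Y t \<omega> $ j \<le> 1"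
  using Basis_nth_bounds[OF X_Basis] Basis_nth_bounds[OF Y_Basis] by auto

lemma integrable_X: "integrable M (\<lambda>\<omega>. X t \<omega> $ i)"
  by (rule integrable_const_bound[where B = 1]) (auto simp: X_bounds)

lemma integrable_Y: "integrable M (\<lambda>\<omega>. Y t \<omega> $ j)"
  by (rule integrable_const_bound[where B = 1]) (auto simp: Y_bounds)

lemma integrable_YX: "integrable M (\<lambda>\<omega>. Y t \<omega> $ j * X t \<omega> $ i)"
  by (rule integrable_const_bound[where B = 1])
    (auto simp: abs_mult X_bounds Y_bounds intro!: mult_le_one AE_I2)

lemma subalgebra_full: "subalgebra M (full_sigma M X Y t)"
  by (intro subalgebra_full_sigma X_M Y_M)

lemma subalgebra_obs: "subalgebra M (obs_sigma M Y t)"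
  using subalgebra_full[of t] subalgebra_full_obs[of M X Y t] by (auto simp: subalgebra_def)

text \<open>The coordinate \<open>(j, i)\<close> of the Markov property is linear in
  \<open>X t\<close>, so conditioning it further on the observations turns \<open>X t\<close> into
  the filter. The index types are finite, so one null set serves all \<open>j\<close> and
  \<open>i\<close>.\<close>

lemma joint_prediction:
  "AE \<omega> in M. \<forall>j i. real_cond_exp M (obs_sigma M Y t) (\<lambda>\<omega>. Y (Suc t) \<omega> $ j * X (Suc t) \<omega> $ i) \<omega>
     = (Q j *v filter_X M X Y t \<omega>) $ i"
proof -
  interpret O: sigma_finite_subalgebra M "obs_sigma M Y t"
    by (rule sigma_finite_subalgebraI[OF subalgebra_obs])
  have *: "AE \<omega> in M. real_cond_exp M (obs_sigma M Y t) (\<lambda>\<omega>. Y (Suc t) \<omega> $ j * X (Suc t) \<omega> $ i) \<omega>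
     = (Q j *v filter_X M X Y t \<omega>) $ i" for j i
  proof -
    let ?f = "\<lambda>\<omega>. Y (Suc t) \<omega> $ j * X (Suc t) \<omega> $ i"
    let ?g = "\<lambda>\<omega>. \<Sum>k\<in>UNIV. Q j $ i $ k * X t \<omega> $ k"
    have "AE \<omega> in M. vec_cond_exp M (full_sigma M X Y t) (\<lambda>\<omega>. kron_vec (Y (Suc t) \<omega>) (X (Suc t) \<omega>)) \<omega>
        = transition_matrix Q *v kron_vec (Y t \<omega>) (X t \<omega>)"
      using markov by (simp add: markov_chain_def)
    then have "AE \<omega> in M. real_cond_exp M (full_sigma M X Y t) ?f \<omega> = ?g \<omega>"
    proof (rule AE_mp, intro AE_I2 impI)
      fix \<omega> assume "\<omega> \<in> space M"
        and eq: "vec_cond_exp M (full_sigma M X Y t) (\<lambda>\<omega>. kron_vec (Y (Suc t) \<omega>) (X (Suc t) \<omega>)) \<omega>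
        = transition_matrix Q *v kron_vec (Y t \<omega>) (X t \<omega>)"
      have "real_cond_exp M (full_sigma M X Y t) ?f \<omega>
          = vec_cond_exp M (full_sigma M X Y t) (\<lambda>\<omega>. kron_vec (Y (Suc t) \<omega>) (X (Suc t) \<omega>)) \<omega> $ (j, i)"
        by (simp add: vec_cond_exp_def kron_vec_def)
      \<comment> \<open>\<open>Y t\<close> is a basis vector, so its entries sum to 1 and the row of
        ones in the transition matrix removes it from the Kronecker product.\<close>
      also have "\<dots> = (stack_blocks Q *v X t \<omega>) $ (j, i)"
        unfolding eq transition_matrix_kron_vec[OF Y_Basis[OF \<open>\<omega> \<in> space M\<close>]] ..
      finally show "real_cond_exp M (full_sigma M X Y t) ?f \<omega> = ?g \<omega>"
        by (simp add: stack_blocks_def matrix_vector_mult_def)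
    qed
    \<comment> \<open>Both sides are conditioned on the observations; the tower property then
      simplifies the left side and linearity the right side.\<close>
    then have "AE \<omega> in M. real_cond_exp M (obs_sigma M Y t) (real_cond_exp M (full_sigma M X Y t) ?f) \<omega>
        = real_cond_exp M (obs_sigma M Y t) ?g \<omega>"
      by (rule O.real_cond_exp_cong) measurable
    moreover have "AE \<omega> in M. real_cond_exp M (obs_sigma M Y t) (real_cond_exp M (full_sigma M X Y t) ?f) \<omega>
        = real_cond_exp M (obs_sigma M Y t) ?f \<omega>"
      by (rule O.real_cond_exp_nested_subalg[OF subalgebra_full subalgebra_full_obs integrable_YX])
    moreover have "AE \<omega> in M. real_cond_exp M (obs_sigma M Y t) ?g \<omega>
        = (\<Sum>k\<in>UNIV. real_cond_exp M (obs_sigma M Y t) (\<lambda>\<omega>. Q j $ i $ k * X t \<omega> $ k) \<omega>)"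
      by (rule O.real_cond_exp_sum) (intro integrable_mult_right integrable_X)
    moreover have "AE \<omega> in M. \<forall>k. real_cond_exp M (obs_sigma M Y t) (\<lambda>\<omega>. Q j $ i $ k * X t \<omega> $ k) \<omega>
        = Q j $ i $ k * real_cond_exp M (obs_sigma M Y t) (\<lambda>\<omega>. X t \<omega> $ k) \<omega>"
      unfolding AE_all_countable by (intro allI O.real_cond_exp_cmult integrable_X)
    ultimately show ?thesis
      by eventually_elim (simp add: filter_X_def vec_cond_exp_def matrix_vector_mult_def)
  qed
  then show ?thesis by (simp add: AE_all_countable)
qed

text \<open>The entries of \<open>X (Suc t)\<close> sum to 1, so summing
  \<open>joint_prediction\<close> over \<open>i\<close> removes the state. The result is the
  denominator of column \<open>j\<close> of the filter matrix.\<close>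

lemma observation_prediction:
  "AE \<omega> in M. \<forall>j. real_cond_exp M (obs_sigma M Y t) (\<lambda>\<omega>. Y (Suc t) \<omega> $ j) \<omega>
     = ones \<bullet> (Q j *v filter_X M X Y t \<omega>)"
  unfolding AE_all_countable
proof
  fix j
  interpret O: sigma_finite_subalgebra M "obs_sigma M Y t"
    by (rule sigma_finite_subalgebraI[OF subalgebra_obs])
  have "AE \<omega> in M. real_cond_exp M (obs_sigma M Y t) (\<lambda>\<omega>. Y (Suc t) \<omega> $ j) \<omega>
      = real_cond_exp M (obs_sigma M Y t) (\<lambda>\<omega>. \<Sum>i\<in>UNIV. Y (Suc t) \<omega> $ j * X (Suc t) \<omega> $ i) \<omega>"
    by (rule O.real_cond_exp_cong)
      (auto simp: sum_distrib_left[symmetric] sum_Basis_nth[OF X_Basis])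
  moreover have "AE \<omega> in M. real_cond_exp M (obs_sigma M Y t)
        (\<lambda>\<omega>. \<Sum>i\<in>UNIV. Y (Suc t) \<omega> $ j * X (Suc t) \<omega> $ i) \<omega>
      = (\<Sum>i\<in>UNIV. real_cond_exp M (obs_sigma M Y t) (\<lambda>\<omega>. Y (Suc t) \<omega> $ j * X (Suc t) \<omega> $ i) \<omega>)"
    by (rule O.real_cond_exp_sum) (rule integrable_YX)
  ultimately show "AE \<omega> in M. real_cond_exp M (obs_sigma M Y t) (\<lambda>\<omega>. Y (Suc t) \<omega> $ j) \<omega>
     = ones \<bullet> (Q j *v filter_X M X Y t \<omega>)"
    using joint_prediction[of t] by eventually_elim (simp add: inner_ones)
qed

text \<open>Here the entries of \<open>Y (Suc t)\<close> sum to 1, and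
  \<open>joint_prediction\<close> is summed over \<open>j\<close>.\<close>

lemma state_prediction:
  "AE \<omega> in M. vec_cond_exp M (obs_sigma M Y t) (X (Suc t)) \<omega> = (\<Sum>i\<in>UNIV. Q i) *v filter_X M X Y t \<omega>"
proof -
  interpret O: sigma_finite_subalgebra M "obs_sigma M Y t"
    by (rule sigma_finite_subalgebraI[OF subalgebra_obs])
  have mult_sum: "(\<Sum>i\<in>UNIV. Q i) *v x = (\<Sum>i\<in>UNIV. Q i *v x)" for x
    by (simp add: vec_eq_iff matrix_vector_mult_def sum_distrib_right) (intro allI sum.swap)
  have "AE \<omega> in M. \<forall>i. real_cond_exp M (obs_sigma M Y t) (\<lambda>\<omega>. X (Suc t) \<omega> $ i) \<omega>
      = real_cond_exp M (obs_sigma M Y t) (\<lambda>\<omega>. \<Sum>j\<in>UNIV. Y (Suc t) \<omega> $ j * X (Suc t) \<omega> $ i) \<omega>"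
    unfolding AE_all_countable
    by (intro allI O.real_cond_exp_cong)
      (auto simp: sum_distrib_right[symmetric] sum_Basis_nth[OF Y_Basis])
  moreover have "AE \<omega> in M. \<forall>i. real_cond_exp M (obs_sigma M Y t)
        (\<lambda>\<omega>. \<Sum>j\<in>UNIV. Y (Suc t) \<omega> $ j * X (Suc t) \<omega> $ i) \<omega>
      = (\<Sum>j\<in>UNIV. real_cond_exp M (obs_sigma M Y t) (\<lambda>\<omega>. Y (Suc t) \<omega> $ j * X (Suc t) \<omega> $ i) \<omega>)"
    unfolding AE_all_countable by (intro allI O.real_cond_exp_sum integrable_YX)
  ultimately show ?thesis
    using joint_prediction[of t]
    by eventually_elim (simp add: vec_eq_iff vec_cond_exp_def mult_sum)
qed

text \<open>The quantifier over the uncountably many \<open>d\<close> may stand inside the almost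
  sure statement: the null set is chosen so that outside it the selected column has a nonzero
  denominator, for which \<open>d\<close> is never consulted.\<close>

lemma filter_step:
  "AE \<omega> in M. \<forall>d. filter_X M X Y (Suc t) \<omega> = filter_matrix Q d (filter_X M X Y t \<omega>) *v Y (Suc t) \<omega>"
proof -
  let ?O = "obs_sigma M Y t"
  have bayes: "AE \<omega> in M. \<forall>i. filter_X M X Y (Suc t) \<omega> $ i =
      (\<Sum>j\<in>UNIV. Y (Suc t) \<omega> $ j * (real_cond_exp M ?O (\<lambda>\<omega>. Y (Suc t) \<omega> $ j * X (Suc t) \<omega> $ i) \<omega>
                           / real_cond_exp M ?O (\<lambda>\<omega>. Y (Suc t) \<omega> $ j) \<omega>))"
    unfolding AE_all_countable filter_X_def vec_cond_exp_def vec_lambda_beta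
    by (intro allI bayes_real_cond_exp subalgebra_obs sets_obs_sigma_Suc Y_Basis X_component X_bounds)
  have "AE \<omega> in M. \<forall>j. real_cond_exp M ?O (\<lambda>\<omega>. Y (Suc t) \<omega> $ j) \<omega> = 0 \<longrightarrow> Y (Suc t) \<omega> $ j = 0"
    unfolding AE_all_countable
    by (intro allI AE_eq_0_if_real_cond_exp_eq_0 subalgebra_obs integrable_Y) (simp add: Y_bounds)
  with bayes joint_prediction[of t] observation_prediction[of t] AE_space[of M] show ?thesis
  proof eventually_elim
    case (elim \<omega>)
    obtain k where k: "Y (Suc t) \<omega> = axis k 1"
      using Y_Basis[OF elim(4)] by (rule Basis_vec_cases)
    \<comment> \<open>Otherwise coordinate \<open>k\<close> of the observation would be 0, whereas
      it is 1.\<close>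
    have "ones \<bullet> (Q k *v filter_X M X Y t \<omega>) \<noteq> 0"
      using elim(3,5) k by (auto simp: axis_def)
    \<comment> \<open>The rule \<open>times_divide_eq_right\<close> would destroy the product shape
      that \<open>sum_axis_mult\<close> matches.\<close>
    then show ?case
      using elim(1,2,3) by (simp add: k filter_matrix_mult_axis sum_axis_mult vec_eq_iff
          del: times_divide_eq_right)
  qed
qed

text \<open>Over the trivial sigma-algebra the conditional expectations in Bayes' formula are
  expectations, and these are point masses of the law of
  \<open>kron_vec (Y 0 \<omega>) (X 0 \<omega>)\<close> and their sums. Both sides divide by the
  same number, so the convention for division by zero cannot separate them.\<close>

lemma initial_filter_bayes:
  "AE \<omega> in M. filter_X M X Y 0 \<omega>
    = initial_filter (distr M borel (\<lambda>\<omega>. kron_vec (Y 0 \<omega>) (X 0 \<omega>))) (Y 0 \<omega>)"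
proof -
  let ?T = "trivial_sigma M" and ?\<mu> = "distr M borel (\<lambda>\<omega>. kron_vec (Y 0 \<omega>) (X 0 \<omega>))"
  have Z_M: "(\<lambda>\<omega>. kron_vec (Y 0 \<omega>) (X 0 \<omega>)) \<in> borel_measurable M"
    using markov subalgebra_full[of 0] by (auto simp: markov_chain_def intro: measurable_from_subalg)
  have \<mu>: "measure ?\<mu> {kron_vec (axis j 1) (axis i 1)} = expectation (\<lambda>\<omega>. Y 0 \<omega> $ j * X 0 \<omega> $ i)" for j i
  proof -
    let ?S = "(\<lambda>\<omega>. kron_vec (Y 0 \<omega>) (X 0 \<omega>)) -` {kron_vec (axis j 1) (axis i 1)} \<inter> space M"
    have S: "?S \<in> sets M" using Z_M by (rule measurable_sets) simp
    have ind: "indicator ?S \<omega> = Y 0 \<omega> $ j * X 0 \<omega> $ i" if \<omega>: "\<omega> \<in> space M" for \<omega>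
    proof -
      obtain k l where kl: "Y 0 \<omega> = axis k 1" "X 0 \<omega> = axis l 1"
        using X_Basis[OF \<omega>, of 0] Y_Basis[OF \<omega>, of 0] by (metis Basis_vec_cases)
      have "kron_vec (axis k 1) (axis l 1) = kron_vec (axis j 1) (axis i 1) \<longleftrightarrow> k = j \<and> l = i"
      proof
        assume "kron_vec (axis k 1) (axis l 1) = kron_vec (axis j 1) (axis i 1)"
        \<comment> \<open>Coordinate \<open>(j, i)\<close> is 1 on the right; on the left it is 1
          only if both indices match.\<close>
        then have "kron_vec (axis k 1) (axis l 1) $ (j, i) = kron_vec (axis j 1) (axis i 1) $ (j, i)"
          by simp
        then show "k = j \<and> l = i" by (auto simp: kron_vec_def axis_def split: if_splits)
      qed auto
      then show ?thesis using \<omega> by (auto simp: kl indicator_def axis_def)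
    qed
    have "measure ?\<mu> {kron_vec (axis j 1) (axis i 1)} = prob ?S"
      using Z_M by (simp add: measure_distr)
    also have "\<dots> = expectation (indicator ?S)"
      using S by simp
    also have "\<dots> = expectation (\<lambda>\<omega>. Y 0 \<omega> $ j * X 0 \<omega> $ i)"
      using ind by (rule Bochner_Integration.integral_cong[OF refl])
    finally show ?thesis .
  qed
  \<comment> \<open>The denominator in \<open>initial_filter\<close> is the probability of the
    observed value of \<open>Y 0\<close>.\<close>
  have \<mu>_sum: "(\<Sum>i\<in>UNIV. expectation (\<lambda>\<omega>. Y 0 \<omega> $ j * X 0 \<omega> $ i)) = expectation (\<lambda>\<omega>. Y 0 \<omega> $ j)" for j
  proof -
    have "(\<Sum>i\<in>UNIV. expectation (\<lambda>\<omega>. Y 0 \<omega> $ j * X 0 \<omega> $ i))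
        = expectation (\<lambda>\<omega>. \<Sum>i\<in>UNIV. Y 0 \<omega> $ j * X 0 \<omega> $ i)"
      by (rule Bochner_Integration.integral_sum[symmetric]) (rule integrable_YX)
    also have "\<dots> = expectation (\<lambda>\<omega>. Y 0 \<omega> $ j)"
      by (rule Bochner_Integration.integral_cong)
        (simp_all add: sum_distrib_left[symmetric] sum_Basis_nth[OF X_Basis])
    finally show ?thesis .
  qed
  have "AE \<omega> in M. \<forall>i. filter_X M X Y 0 \<omega> $ i =
      (\<Sum>j\<in>UNIV. Y 0 \<omega> $ j * (real_cond_exp M ?T (\<lambda>\<omega>. Y 0 \<omega> $ j * X 0 \<omega> $ i) \<omega>
                           / real_cond_exp M ?T (\<lambda>\<omega>. Y 0 \<omega> $ j) \<omega>))"
    unfolding AE_all_countable filter_X_def vec_cond_exp_def vec_lambda_beta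
    by (intro allI bayes_real_cond_exp subalgebra_obs subalgebra_trivial_sigma sets_obs_sigma_0
        Y_Basis X_component X_bounds)
  moreover have "AE \<omega> in M. \<forall>j i. real_cond_exp M ?T (\<lambda>\<omega>. Y 0 \<omega> $ j * X 0 \<omega> $ i) \<omega>
      = expectation (\<lambda>\<omega>. Y 0 \<omega> $ j * X 0 \<omega> $ i)"
    unfolding AE_all_countable by (intro allI real_cond_exp_trivial_sigma integrable_YX)
  moreover have "AE \<omega> in M. \<forall>j. real_cond_exp M ?T (\<lambda>\<omega>. Y 0 \<omega> $ j) \<omega> = expectation (\<lambda>\<omega>. Y 0 \<omega> $ j)"
    unfolding AE_all_countable by (intro allI real_cond_exp_trivial_sigma integrable_Y)
  ultimately show ?thesis
    using AE_space[of M]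
  proof eventually_elim
    case (elim \<omega>)
    obtain k where k: "Y 0 \<omega> = axis k 1"
      using Y_Basis[OF elim(4)] by (rule Basis_vec_cases)
    show ?case
      using elim(1-3) by (simp add: k sum_axis_mult vec_eq_iff initial_filter_def \<mu> \<mu>_sum
          del: times_divide_eq_right)
  qed
qed

text \<open>The left side is formed coordinate by coordinate, the right side is a Bochner integral
  of vectors; they meet because taking a coordinate is bounded linear and commutes with the
  integral.\<close>

lemma initial_prediction:
  "AE \<omega> in M. vec_cond_exp M (trivial_sigma M) (X 0) \<omega> = expectation (X 0)"
proof -
  have "integrable M (X 0)"
    by (rule integrable_const_bound[where B = 1])
      (use X_Basis X_M in \<open>auto intro!: AE_I2 simp: norm_Basis\<close>)
  then have "expectation (\<lambda>\<omega>. X 0 \<omega> $ i) = expectation (X 0) $ i" for i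
    by (rule integral_bounded_linear[OF bounded_linear_vec_nth])
  moreover have "AE \<omega> in M. \<forall>i. real_cond_exp M (trivial_sigma M) (\<lambda>\<omega>. X 0 \<omega> $ i) \<omega>
      = expectation (\<lambda>\<omega>. X 0 \<omega> $ i)"
    unfolding AE_all_countable by (intro allI real_cond_exp_trivial_sigma integrable_X)
  ultimately show ?thesis
    by (auto simp: vec_cond_exp_def vec_eq_iff)
qed

end

theorem theorem5p1:
  fixes M :: "'a measure"
    and X :: "nat \<Rightarrow> 'a \<Rightarrow> real^'n"
    and Y :: "nat \<Rightarrow> 'a \<Rightarrow> real^'m"
    and Q :: "'m::finite \<Rightarrow> real^'n^'n"
  assumes "prob_space M"
    and "\<And>t. X t \<in> borel_measurable M"
    and "\<And>t. Y t \<in> borel_measurable M"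
    and "\<And>t \<omega>. \<omega> \<in> space M \<Longrightarrow> X t \<omega> \<in> Basis"
    and "\<And>t \<omega>. \<omega> \<in> space M \<Longrightarrow> Y t \<omega> \<in> Basis"
    and "markov_chain M (full_sigma M X Y) (\<lambda>t \<omega>. kron_vec (Y t \<omega>) (X t \<omega>)) (transition_matrix Q)"
  shows "(AE \<omega> in M. \<forall>t\<ge>1. \<forall>d.
            filter_X M X Y t \<omega> = filter_matrix Q d (filter_X M X Y (t - 1) \<omega>) *v Y t \<omega>)
       \<and> (AE \<omega> in M. filter_X M X Y 0 \<omega>
            = vec_cond_exp M (vimage_algebra (space M) (Y 0) borel) (X 0) \<omega>)
       \<and> (AE \<omega> in M. filter_X M X Y 0 \<omega>
            = initial_filter (distr M borel (\<lambda>\<omega>. kron_vec (Y 0 \<omega>) (X 0 \<omega>))) (Y 0 \<omega>))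
       \<and> (\<forall>t. AE \<omega> in M. vec_cond_exp M (obs_sigma M Y t) (X (Suc t)) \<omega>
            = (\<Sum>i\<in>UNIV. Q i) *v filter_X M X Y t \<omega>)
       \<and> (AE \<omega> in M. vec_cond_exp M (trivial_sigma M) (X 0) \<omega> = prob_space.expectation M (X 0))
       \<and> (\<forall>t. AE \<omega> in M. vec_cond_exp M (obs_sigma M Y t) (Y (Suc t)) \<omega>
            = output_matrix Q *v filter_X M X Y t \<omega>)"
proof -
  interpret prob_space M by fact
  interpret hidden_markov_model M X Y Q
    using assms by unfold_locales auto
  \<comment> \<open>There are countably many times, so the exceptional null sets of the single steps
    combine into one.\<close>
  have "AE \<omega> in M. \<forall>t. \<forall>d. filter_X M X Y (Suc t) \<omega>
      = filter_matrix Q d (filter_X M X Y t \<omega>) *v Y (Suc t) \<omega>"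
    unfolding AE_all_countable by (intro allI filter_step)
  then have "AE \<omega> in M. \<forall>t\<ge>1. \<forall>d. filter_X M X Y t \<omega>
      = filter_matrix Q d (filter_X M X Y (t - 1) \<omega>) *v Y t \<omega>"
    by eventually_elim (metis One_nat_def Suc_diff_1 Suc_le_lessD)
  moreover have "AE \<omega> in M. vec_cond_exp M (obs_sigma M Y t) (Y (Suc t)) \<omega>
      = output_matrix Q *v filter_X M X Y t \<omega>" for t
    using observation_prediction[of t]
    by eventually_elim (simp add: vec_eq_iff vec_cond_exp_def output_matrix_mult)
  \<comment> \<open>This holds everywhere, since both sides condition on the same
    sigma-algebra.\<close>
  moreover have "filter_X M X Y 0 = vec_cond_exp M (vimage_algebra (space M) (Y 0) borel) (X 0)"
    by (simp add: filter_X_def obs_sigma_0)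
  ultimately show ?thesis
    using initial_filter_bayes state_prediction initial_prediction by simp
qed

end
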